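(* Let $(\beta_n)_{n\ge1}$ be a sequence of positive reals, write $\beta=\beta_n$, such that either $\frac{1}{n^2}\ll\beta\ll\frac1n$ as $n\to\infty$, or $\beta=2\gamma n^{-1}$ for some fixed $\gamma\in(0,1)$. Let $H=H^{(n)}$ be the $n\times n$ random symmetric tridiagonal matrix whose diagonal and superdiagonal entries are all independent, with $H(i,i)\sim\mathcal{N}(0,2)$ for $1\le i\le n$ and $H(i,i+1)=H(i+1,i)\sim\chi((n-i)\beta)$ for $1\le i\le n-1$, and let $\lambda_{\max}(H)$ be its largest eigenvalue. Then there exist constants $0<c<c'<+\infty$ such that $$\mathbb{P}\left(\frac{\lambda_{\max}(H)}{\sqrt{\log n}}\in[c,c']\right)\longrightarrow 1\qquad\text{as } n\to\infty.$$
   Context: For positive sequences, $u_n\ll v_n$ means $u_n/v_n\to0$ as $n\to\infty$. $\mathcal{N}(0,2)$ is the centered Gaussian law with variance $2$. For real $k>0$, $\chi(k)$ is the law of $\sqrt{Y}$ where $Y$ has the Gamma density $\frac{(1/2)^{k/2}y^{k/2-1}e^{-y/2}}{\Gamma(k/2)}$ on $(0,\infty)$. *)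

theory Defs
  imports "HOL-Probability.Probability" "Jordan_Normal_Form.Spectral_Radius"
begin

definition much_less :: "(nat \<Rightarrow> real) \<Rightarrow> (nat \<Rightarrow> real) \<Rightarrow> bool" (infix "\<lless>" 50) where
  "u \<lless> v \<longleftrightarrow> (\<lambda>n. u n / v n) \<longlonglongrightarrow> 0"

text \<open>Gamma density with shape \<open>k / 2\<close> and rate \<open>1 / 2\<close>, for an arbitrary real \<open>k > 0\<close>
  (the library's Erlang densities only cover integer shapes).\<close>

definition chi_square_density :: "real \<Rightarrow> real \<Rightarrow> real" where
  "chi_square_density k y =
    (if y > 0 then (1/2) powr (k/2) * y powr (k/2 - 1) * exp (- y / 2) / Gamma (k/2) else 0)"

definition chi_distribution :: "real \<Rightarrow> real measure" where
  "chi_distribution k = distr (density lborel (chi_square_density k)) borel sqrt"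

text \<open>Matrix indices start at \<open>0\<close>, so the 1-based entry \<open>(i, i + 1)\<close> with parameter \<open>(n - i) b\<close>
  is entry \<open>(i, Suc i)\<close> with parameter \<open>(n - Suc i) b\<close> here.  The second argument of
  \<^const>\<open>normal_density\<close> is the standard deviation.\<close>

definition tridiagonal_beta_matrix ::
  "'a measure \<Rightarrow> nat \<Rightarrow> real \<Rightarrow> ('a \<Rightarrow> real mat) \<Rightarrow> bool" where
  "tridiagonal_beta_matrix M n b H \<longleftrightarrow>
     prob_space M \<and>
     (\<forall>\<omega>\<in>space M.
        H \<omega> \<in> carrier_mat n n \<and>
        (\<forall>i<n. \<forall>j<n. H \<omega> $$ (i, j) = H \<omega> $$ (j, i)) \<and>
        (\<forall>i<n. \<forall>j<n. Suc i < j \<longrightarrow> H \<omega> $$ (i, j) = 0)) \<and>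
     prob_space.indep_vars M (\<lambda>_. borel) (\<lambda>ij \<omega>. H \<omega> $$ ij)
       {(i, j). i < n \<and> j < n \<and> (j = i \<or> j = Suc i)} \<and>
     (\<forall>i<n. distributed M lborel (\<lambda>\<omega>. H \<omega> $$ (i, i)) (normal_density 0 (sqrt 2))) \<and>
     (\<forall>i. Suc i < n \<longrightarrow>
        distr M borel (\<lambda>\<omega>. H \<omega> $$ (i, Suc i)) = chi_distribution (real (n - Suc i) * b))"

definition max_eigenvalue :: "real mat \<Rightarrow> real" where
  "max_eigenvalue A = Max (spectrum A)"

end

theory Submission
  imports Defs "HOL-Real_Asymp.Real_Asymp"
begin

text \<open>The largest eigenvalue of a symmetric matrix is the maximum of its quadratic form on the unit
  sphere.  Hence it is at least every diagonal entry and, for a tridiagonal matrix, at most three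
  times the largest absolute value of an entry.  Among \<open>n\<close> independent Gaussians with variance 2
  one exceeds \<open>sqrt (ln n)\<close> with probability tending to 1.  In both regimes the parameters of
  the \<open>\<chi>\<close> entries are bounded, so every entry has a Gaussian tail with uniform constants, and a
  union bound shows that none exceeds \<open>4 * sqrt (ln n)\<close>.  This gives \<open>c = 1\<close> and \<open>c' = 12\<close>.\<close>

section \<open>Quadratic forms and the variational description of the largest eigenvalue\<close>

text \<open>The argument is a function on \<open>nat\<close> rather than a \<open>vec\<close>, so
  that the product topology on functions supplies continuity and compactness. Only its first
  \<open>n\<close> coordinates enter.\<close>

definition quadratic_form :: "nat \<Rightarrow> real mat \<Rightarrow> (nat \<Rightarrow> real) \<Rightarrow> real" where
  "quadratic_form n A x = (\<Sum>i<n. \<Sum>j<n. A $$ (i, j) * (x i * x j))"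

lemma quadratic_form_cong:
  "(\<And>i. i < n \<Longrightarrow> x i = y i) \<Longrightarrow> quadratic_form n A x = quadratic_form n A y"
  by (simp add: quadratic_form_def)

lemma quadratic_form_scale:
  "quadratic_form n A (\<lambda>i. c * x i) = c\<^sup>2 * quadratic_form n A x"
  by (simp add: quadratic_form_def sum_distrib_left power2_eq_square mult_ac)

text \<open>Symmetry merges the two cross terms of the expansion. The result is the second-order
  expansion in \<open>t\<close> behind the variational argument for the maximiser.\<close>

lemma quadratic_form_add_scale:
  assumes sym: "\<And>i j. i < n \<Longrightarrow> j < n \<Longrightarrow> A $$ (i, j) = A $$ (j, i)"
  shows "quadratic_form n A (\<lambda>i. x i + t * y i) =
    quadratic_form n A x + 2 * t * (\<Sum>i<n. y i * (\<Sum>j<n. A $$ (i, j) * x j))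
      + t\<^sup>2 * quadratic_form n A y"
proof -
  have dual: "(\<Sum>i<n. \<Sum>j<n. A $$ (i, j) * (y i * x j)) = (\<Sum>i<n. y i * (\<Sum>j<n. A $$ (i, j) * x j))"
    by (simp add: sum_distrib_left mult_ac)
  have swap: "(\<Sum>i<n. \<Sum>j<n. A $$ (i, j) * (x i * y j)) = (\<Sum>i<n. y i * (\<Sum>j<n. A $$ (i, j) * x j))"
    unfolding dual[symmetric] by (subst sum.swap) (intro sum.cong refl, simp add: sym mult_ac)
  have "quadratic_form n A (\<lambda>i. x i + t * y i) =
    quadratic_form n A x + t * (\<Sum>i<n. \<Sum>j<n. A $$ (i, j) * (x i * y j))
      + t * (\<Sum>i<n. \<Sum>j<n. A $$ (i, j) * (y i * x j)) + t\<^sup>2 * quadratic_form n A y"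
    unfolding quadratic_form_def sum_distrib_left sum.distrib[symmetric]
    by (intro sum.cong refl) (simp add: algebra_simps power2_eq_square)
  then show ?thesis
    unfolding swap dual by simp
qed

lemma continuous_on_quadratic_form: "continuous_on S (quadratic_form n A)"
  unfolding quadratic_form_def[abs_def]
  by (intro continuous_intros continuous_on_product_then_coordinatewise continuous_on_id)

text \<open>The unit sphere is compact and the form is continuous, so a maximiser exists there;
  homogeneity of degree two carries the inequality from the sphere to every
  \<open>y\<close>.\<close>

lemma quadratic_form_attains_max:
  assumes "n \<ge> 1"
  obtains x where "(\<Sum>i<n. (x i)\<^sup>2) = 1"
    "\<And>y. quadratic_form n A y \<le> quadratic_form n A x * (\<Sum>i<n. (y i)\<^sup>2)"
proof -
  \<comment> \<open>Coordinates from \<open>n\<close> on are pinned to 0, so that the sphere sits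
    inside a product of compact sets, which is compact by Tychonoff although the space of all
    functions is infinite-dimensional.\<close>
  define B where "B = (\<Pi>\<^sub>E i\<in>UNIV. if i < n then {-1..1::real} else {0})"
  define S where "S = B \<inter> {x. (\<Sum>i<n. (x i)\<^sup>2) = 1}"
  have "compactin (product_topology (\<lambda>i. euclidean) UNIV) B"
    unfolding B_def by (subst compactin_PiE) auto
  then have "compact B"
    by (simp add: euclidean_product_topology)
  moreover have "closed {x::nat \<Rightarrow> real. (\<Sum>i<n. (x i)\<^sup>2) = 1}"
    by (intro closed_Collect_eq continuous_intros continuous_on_product_then_coordinatewise continuous_on_id)
  ultimately have "compact S"
    unfolding S_def by (rule compact_Int_closed)
  moreover have "(\<lambda>i. if i = 0 then 1 else 0) \<in> S"
    using assms by (auto simp: S_def B_def if_distrib[of "\<lambda>x. x\<^sup>2"] cong: if_cong)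
  then have "S \<noteq> {}" by auto
  ultimately obtain x where x: "x \<in> S" and max: "\<And>y. y \<in> S \<Longrightarrow> quadratic_form n A y \<le> quadratic_form n A x"
    using continuous_attains_sup[OF _ _ continuous_on_quadratic_form[of S n A]] by metis
  show ?thesis
  proof (rule that)
    show "(\<Sum>i<n. (x i)\<^sup>2) = 1" using x by (simp add: S_def)
    fix y :: "nat \<Rightarrow> real"
    define s where "s = (\<Sum>i<n. (y i)\<^sup>2)"
    have s0: "s \<ge> 0" unfolding s_def by (intro sum_nonneg) auto
    have yi: "(y i)\<^sup>2 \<le> s" if "i < n" for i
      unfolding s_def using that by (intro member_le_sum) auto
    show "quadratic_form n A y \<le> quadratic_form n A x * (\<Sum>i<n. (y i)\<^sup>2)"
    proof (cases "s = 0")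
      case True
      with yi have "\<And>i. i < n \<Longrightarrow> y i = 0" by fastforce
      then show ?thesis by (simp add: quadratic_form_def)
    next
      case False
      with s0 have s: "s > 0" by simp
      \<comment> \<open>Normalising \<open>y\<close> is not enough: its coordinates from
        \<open>n\<close> on must also be cut to 0 for \<open>z\<close> to lie in \<open>S\<close>.
        The form does not see the difference.\<close>
      define z where "z i = (if i < n then 1 / sqrt s * y i else 0)" for i
      have zout: "z i = 0" if "\<not> i < n" for i using that by (simp add: z_def)
      have zsum: "(\<Sum>i<n. (z i)\<^sup>2) = 1"
        using s by (simp add: z_def power_mult_distrib power_divide sum_divide_distrib[symmetric] s_def[symmetric])
      have "\<bar>z i\<bar> \<le> 1" for i
      proof (cases "i < n")
        case True
        then have "(z i)\<^sup>2 \<le> (\<Sum>i<n. (z i)\<^sup>2)" by (intro member_le_sum) auto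
        then show ?thesis by (simp add: zsum abs_square_le_1)
      qed (simp add: z_def)
      then have "z \<in> S"
        using zsum zout by (auto simp: S_def B_def abs_le_iff minus_le_iff)
      from max[OF this] have "quadratic_form n A (\<lambda>i. 1 / sqrt s * y i) \<le> quadratic_form n A x"
        using quadratic_form_cong[of n z "\<lambda>i. 1 / sqrt s * y i" A] by (simp add: z_def)
      then show ?thesis
        unfolding quadratic_form_scale s_def[symmetric] using s by (simp add: power_divide field_simps)
    qed
  qed
qed

lemma mat_mult_vec_index_sum:
  assumes "A \<in> carrier_mat n n" "v \<in> carrier_vec n" "i < n"
  shows "(A *\<^sub>v v) $ i = (\<Sum>j<n. A $$ (i, j) * v $ j)"
  using assms by (auto simp: scalar_prod_def atLeast0LessThan intro!: sum.cong)

text \<open>At an eigenvector \<open>v\<close> the form equals \<open>k\<close> times the squared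
  norm of \<open>v\<close>, which is positive and can be cancelled.\<close>

lemma quadratic_form_le_imp_eigenvalue_le:
  assumes A: "A \<in> carrier_mat n n" and ev: "eigenvalue A k"
    and le: "\<And>y. quadratic_form n A y \<le> t * (\<Sum>i<n. (y i)\<^sup>2)"
  shows "k \<le> t"
proof -
  from ev A obtain v where v: "v \<in> carrier_vec n" "v \<noteq> 0\<^sub>v n" "A *\<^sub>v v = k \<cdot>\<^sub>v v"
    by (auto simp: eigenvalue_def eigenvector_def)
  have row: "(\<Sum>j<n. A $$ (i, j) * v $ j) = k * v $ i" if "i < n" for i
    using mat_mult_vec_index_sum[OF A v(1) that] v that by simp
  have "quadratic_form n A (($) v) = (\<Sum>i<n. v $ i * (\<Sum>j<n. A $$ (i, j) * v $ j))"
    by (simp add: quadratic_form_def sum_distrib_left mult_ac)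
  also have "\<dots> = k * (\<Sum>i<n. (v $ i)\<^sup>2)"
    unfolding sum_distrib_left[of k] by (intro sum.cong refl) (simp add: row power2_eq_square)
  finally have "k * (\<Sum>i<n. (v $ i)\<^sup>2) \<le> t * (\<Sum>i<n. (v $ i)\<^sup>2)"
    using le by metis
  moreover have "(\<Sum>i<n. (v $ i)\<^sup>2) > 0"
  proof -
    obtain i where "i < n" "v $ i \<noteq> 0"
      using v by (metis carrier_vecD eq_vecI index_zero_vec(1) index_zero_vec(2))
    then show ?thesis by (intro sum_pos2[of _ i]) auto
  qed
  ultimately show ?thesis by simp
qed

text \<open>The maximiser of the form on the unit sphere is an eigenvector: with \<open>r\<close> its residual,
  the first-order variation of the nonnegative form \<open>\<mu> |y|\<^sup>2 - y \<cdot> A y\<close> in direction \<open>r\<close> is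
  \<open>2 |r|\<^sup>2\<close>, and it must vanish.\<close>

lemma max_eigenvalue_attained:
  assumes A: "A \<in> carrier_mat n n" and n: "n \<ge> 1"
    and sym: "\<And>i j. i < n \<Longrightarrow> j < n \<Longrightarrow> A $$ (i, j) = A $$ (j, i)"
  obtains x where "(\<Sum>i<n. (x i)\<^sup>2) = 1" "quadratic_form n A x = max_eigenvalue A"
    "\<And>y. quadratic_form n A y \<le> max_eigenvalue A * (\<Sum>i<n. (y i)\<^sup>2)"
proof -
  obtain x where x: "(\<Sum>i<n. (x i)\<^sup>2) = 1"
    and max: "\<And>y. quadratic_form n A y \<le> quadratic_form n A x * (\<Sum>i<n. (y i)\<^sup>2)"
    using quadratic_form_attains_max[OF n] by metis
  define \<mu> where "\<mu> = quadratic_form n A x"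
  define r where "r i = \<mu> * x i - (\<Sum>j<n. A $$ (i, j) * x j)" for i
  define R where "R = (\<Sum>i<n. (r i)\<^sup>2)"
  define g where "g = \<mu> * R - quadratic_form n A r"
  have g: "g \<ge> 0" using max[of r] by (simp add: g_def R_def \<mu>_def)
  have sqs: "(\<Sum>i<n. (x i + t * r i)\<^sup>2) = 1 + 2 * t * (\<Sum>i<n. r i * x i) + t\<^sup>2 * R" for t
    unfolding R_def x[symmetric] sum_distrib_left sum.distrib[symmetric]
    by (intro sum.cong refl) (simp add: power2_eq_square algebra_simps)
  have Req: "R = \<mu> * (\<Sum>i<n. r i * x i) - (\<Sum>i<n. r i * (\<Sum>j<n. A $$ (i, j) * x j))"
    unfolding R_def sum_distrib_left[of \<mu>] sum_subtractf[symmetric]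
    by (intro sum.cong refl) (simp add: r_def power2_eq_square algebra_simps)
  have "0 \<le> \<mu> * (\<Sum>i<n. (x i + t * r i)\<^sup>2) - quadratic_form n A (\<lambda>i. x i + t * r i)" for t
    using max by (simp add: \<mu>_def)
  moreover have "\<mu> * (\<Sum>i<n. (x i + t * r i)\<^sup>2) - quadratic_form n A (\<lambda>i. x i + t * r i)
      = 2 * t * R + t\<^sup>2 * g" for t
  proof -
    have "2 * t * R = 2 * t * (\<mu> * (\<Sum>i<n. r i * x i)) - 2 * t * (\<Sum>i<n. r i * (\<Sum>j<n. A $$ (i, j) * x j))"
      unfolding right_diff_distrib[symmetric] Req[symmetric] ..
    then show ?thesis
      unfolding sqs quadratic_form_add_scale[of n A x t r, OF sym, simplified] \<mu>_def[symmetric] g_def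
      by (simp add: algebra_simps)
  qed
  ultimately have nonneg: "0 \<le> 2 * t * R + t\<^sup>2 * g" for t
    by metis
  \<comment> \<open>The test value is \<open>t = - c\<close>. Dividing by \<open>1 + g\<close>
    instead of \<open>g\<close> avoids a case split on \<open>g = 0\<close>, and the quadratic
    becomes \<open>- (c\<^sup>2 * (2 + g))\<close>, nonnegative only for
    \<open>c = 0\<close>.\<close>
  define c where "c = R / (1 + g)"
  have R: "R = c * (1 + g)"
    using g by (simp add: c_def)
  have "0 \<le> - (c\<^sup>2 * (2 + g))"
    using nonneg[of "- c"] unfolding R by (simp add: algebra_simps power2_eq_square)
  then have "c = 0"
    using g by (simp add: mult_le_0_iff)
  then have "R = 0"
    by (simp add: R)
  then have r0: "r i = 0" if "i < n" for i
    using that by (auto simp: R_def sum_nonneg_eq_0_iff)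
  have "eigenvector A (vec n x) \<mu>"
    unfolding eigenvector_def
  proof (intro conjI)
    show "vec n x \<in> carrier_vec (dim_row A)" using A by simp
    show "vec n x \<noteq> 0\<^sub>v (dim_row A)"
    proof
      assume "vec n x = 0\<^sub>v (dim_row A)"
      then have "x i = 0" if "i < n" for i
        using that A by (metis carrier_matD(1) index_vec index_zero_vec(1))
      then show False using x by simp
    qed
    show "A *\<^sub>v vec n x = \<mu> \<cdot>\<^sub>v vec n x"
    proof (rule eq_vecI)
      fix i assume "i < dim_vec (\<mu> \<cdot>\<^sub>v vec n x)"
      then have i: "i < n" by simp
      show "(A *\<^sub>v vec n x) $ i = (\<mu> \<cdot>\<^sub>v vec n x) $ i"
        using r0[OF i] i by (subst mat_mult_vec_index_sum[OF A]) (auto simp: r_def)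
    qed (use A in auto)
  qed
  then have "\<mu> \<in> spectrum A"
    by (auto simp: spectrum_def eigenvalue_def)
  moreover have "k \<le> \<mu>" if "k \<in> spectrum A" for k
  proof (rule quadratic_form_le_imp_eigenvalue_le[OF A])
    show "eigenvalue A k" using that by (simp add: spectrum_def)
  qed (simp add: \<mu>_def max)
  ultimately have "max_eigenvalue A = \<mu>"
    unfolding max_eigenvalue_def by (intro Max_eqI card_finite_spectrum[OF A]) auto
  with x max show ?thesis
    by (intro that[of x]) (simp_all add: \<mu>_def)
qed

text \<open>Replaces a bound on the eigenvalue by a family of inequalities linear in the entries of
  \<open>A\<close>. Both the entrywise bounds and the proof of measurability rest on this
  form.\<close>

lemma max_eigenvalue_le_iff:
  assumes A: "A \<in> carrier_mat n n" and n: "n \<ge> 1"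
    and sym: "\<And>i j. i < n \<Longrightarrow> j < n \<Longrightarrow> A $$ (i, j) = A $$ (j, i)"
  shows "max_eigenvalue A \<le> t \<longleftrightarrow> (\<forall>y. quadratic_form n A y \<le> t * (\<Sum>i<n. (y i)\<^sup>2))"
proof -
  obtain x where x: "(\<Sum>i<n. (x i)\<^sup>2) = 1" "quadratic_form n A x = max_eigenvalue A"
    and max: "\<And>y. quadratic_form n A y \<le> max_eigenvalue A * (\<Sum>i<n. (y i)\<^sup>2)"
    using max_eigenvalue_attained[OF A n sym] by metis
  show ?thesis
  proof
    assume t: "max_eigenvalue A \<le> t"
    show "\<forall>y. quadratic_form n A y \<le> t * (\<Sum>i<n. (y i)\<^sup>2)"
      by (intro allI order_trans[OF max] mult_right_mono t sum_nonneg) auto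
  qed (use x in \<open>metis mult.right_neutral\<close>)
qed

section \<open>Bounds on the largest eigenvalue by matrix entries\<close>

text \<open>Evaluate the form at the \<open>i\<close>-th standard basis vector.\<close>

lemma diagonal_le_max_eigenvalue:
  assumes A: "A \<in> carrier_mat n n" and n: "n \<ge> 1"
    and sym: "\<And>i j. i < n \<Longrightarrow> j < n \<Longrightarrow> A $$ (i, j) = A $$ (j, i)"
    and i: "i < n"
  shows "A $$ (i, i) \<le> max_eigenvalue A"
proof -
  define e where "e j = (if j = i then 1 else 0 :: real)" for j
  have "quadratic_form n A e = A $$ (i, i)"
    using i by (simp add: quadratic_form_def e_def if_distrib[of "\<lambda>x. _ * x"] if_distrib[of "\<lambda>x. x * _"] cong: if_cong)
  moreover have "(\<Sum>j<n. (e j)\<^sup>2) = 1"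
    using i by (simp add: e_def if_distrib[of "\<lambda>x. x\<^sup>2"] cong: if_cong)
  ultimately show ?thesis
    using max_eigenvalue_le_iff[OF A n sym, of "max_eigenvalue A"] by (metis mult.right_neutral order_refl)
qed

text \<open>A Schur test: each entry is at most \<open>m\<close> times the band indicator
  \<open>N\<close>, the product \<open>y i * y j\<close> is at most the mean of the two squares, and
  by symmetry of \<open>N\<close> only its row sums remain. The constant 3 is the largest possible
  number of band positions in a row.\<close>

lemma max_eigenvalue_tridiagonal_le:
  assumes A: "A \<in> carrier_mat n n" and n: "n \<ge> 1"
    and sym: "\<And>i j. i < n \<Longrightarrow> j < n \<Longrightarrow> A $$ (i, j) = A $$ (j, i)"
    and band: "\<And>i j. i < n \<Longrightarrow> j < n \<Longrightarrow> Suc i < j \<Longrightarrow> A $$ (i, j) = 0"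
    and diag: "\<And>i. i < n \<Longrightarrow> \<bar>A $$ (i, i)\<bar> \<le> m"
    and off: "\<And>i. Suc i < n \<Longrightarrow> \<bar>A $$ (i, Suc i)\<bar> \<le> m"
  shows "max_eigenvalue A \<le> 3 * m"
proof -
  define N where "N i j = (if i \<le> Suc j \<and> j \<le> Suc i then 1 else 0 :: real)" for i j :: nat
  have m: "m \<ge> 0" using diag[of 0] n by fastforce
  have entry: "\<bar>A $$ (i, j)\<bar> \<le> m * N i j" if ij: "i < n" "j < n" for i j
  proof -
    consider "i = j" | "j = Suc i" | "i = Suc j" | "Suc i < j" | "Suc j < i" by linarith
    then show ?thesis
    proof cases
      case 3
      then show ?thesis using ij off[of j] unfolding sym[OF ij] by (simp add: N_def)
    next
      case 5
      then show ?thesis using ij band[of j i] unfolding sym[OF ij] by (simp add: N_def)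
    qed (use ij diag off band in \<open>auto simp: N_def\<close>)
  qed
  have count: "(\<Sum>j<n. N i j) \<le> 3" for i
  proof -
    have "(\<Sum>j<n. N i j) = real (card {j\<in>{..<n}. i \<le> Suc j \<and> j \<le> Suc i})"
      unfolding N_def by (simp add: sum.If_cases Int_def)
    \<comment> \<open>For \<open>i = 0\<close> truncated subtraction makes \<open>i - 1\<close>
      equal to \<open>i\<close>; the listed set then shrinks but still covers the row.\<close>
    also have "card {j\<in>{..<n}. i \<le> Suc j \<and> j \<le> Suc i} \<le> card {i - 1, i, Suc i}"
      by (intro card_mono) auto
    also have "\<dots> \<le> 3" by (simp add: card_insert_if)
    finally show ?thesis by simp
  qed
  have "quadratic_form n A y \<le> 3 * m * (\<Sum>i<n. (y i)\<^sup>2)" for y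
  proof -
    have "A $$ (i, j) * (y i * y j) \<le> m * N i j * (((y i)\<^sup>2 + (y j)\<^sup>2) / 2)" if ij: "i < n" "j < n" for i j
    proof -
      have "A $$ (i, j) * (y i * y j) \<le> \<bar>A $$ (i, j)\<bar> * \<bar>y i * y j\<bar>"
        by (metis abs_ge_self abs_mult)
      also have "\<bar>y i * y j\<bar> \<le> ((y i)\<^sup>2 + (y j)\<^sup>2) / 2"
        using sum_squares_bound[of "\<bar>y i\<bar>" "\<bar>y j\<bar>"] by (simp add: abs_mult)
      also have "\<bar>A $$ (i, j)\<bar> * (((y i)\<^sup>2 + (y j)\<^sup>2) / 2) \<le> m * N i j * (((y i)\<^sup>2 + (y j)\<^sup>2) / 2)"
        by (intro mult_right_mono entry ij) auto
      finally show ?thesis by (simp add: mult_left_mono)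
    qed
    then have "quadratic_form n A y \<le> (\<Sum>i<n. \<Sum>j<n. m * N i j * (((y i)\<^sup>2 + (y j)\<^sup>2) / 2))"
      unfolding quadratic_form_def by (intro sum_mono) auto
    also have "\<dots> = m / 2 * ((\<Sum>i<n. \<Sum>j<n. N i j * (y i)\<^sup>2) + (\<Sum>i<n. \<Sum>j<n. N i j * (y j)\<^sup>2))"
      unfolding sum_distrib_left sum.distrib[symmetric] by (intro sum.cong refl) (simp add: algebra_simps)
    also have "(\<Sum>i<n. \<Sum>j<n. N i j * (y j)\<^sup>2) = (\<Sum>i<n. \<Sum>j<n. N i j * (y i)\<^sup>2)"
      by (subst sum.swap) (intro sum.cong refl, auto simp: N_def)
    also have "m / 2 * ((\<Sum>i<n. \<Sum>j<n. N i j * (y i)\<^sup>2) + (\<Sum>i<n. \<Sum>j<n. N i j * (y i)\<^sup>2))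
        = m * (\<Sum>i<n. (\<Sum>j<n. N i j) * (y i)\<^sup>2)"
      by (simp add: sum_distrib_right)
    also have "\<dots> \<le> m * (\<Sum>i<n. 3 * (y i)\<^sup>2)"
      by (intro mult_left_mono sum_mono mult_right_mono count m) auto
    finally show ?thesis by (simp add: sum_distrib_left mult_ac)
  qed
  then show ?thesis
    using max_eigenvalue_le_iff[OF A n sym] by blast
qed

section \<open>Tail estimates for the laws of the entries\<close>

lemma borel_measurable_chi_square_density [measurable]: "chi_square_density k \<in> borel_measurable borel"
  unfolding chi_square_density_def[abs_def] by measurable

text \<open>Halving the rate of the Gamma density multiplies it by \<open>2 powr (- k / 2) * exp (y / 4)\<close>.
  The rescaled density again has total mass 1, so no Gamma integral has to be evaluated.\<close>

lemma chi_distribution_tail: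
  assumes "k > 0" "t \<ge> 0" and prob: "prob_space (chi_distribution k)"
  shows "measure (chi_distribution k) {x. t < \<bar>x\<bar>} \<le> 2 powr (k / 2) * exp (- t\<^sup>2 / 4)"
proof -
  let ?f = "chi_square_density k"
  define C where "C = 2 powr (k / 2) * exp (- t\<^sup>2 / 4)"
  have C: "C \<ge> 0" by (simp add: C_def)
  have f0: "?f y \<ge> 0" for y
    using assms by (simp add: chi_square_density_def Gamma_real_nonneg)
  have mass: "(\<integral>\<^sup>+y. ?f y \<partial>lborel) = 1"
    using prob_space.emeasure_space_1[OF prob]
    by (simp add: chi_distribution_def emeasure_distr emeasure_density)
  \<comment> \<open>The shape \<open>0 + 1 / 2 * y\<close> fits the affine substitution rule for
    integrals, whose Jacobian 1/2 absorbs the factor in \<open>C / 2\<close>.\<close>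
  have rescaled: "(\<lambda>y. ennreal (?f (0 + 1 / 2 * y))) \<in> borel_measurable lborel"
    by measurable
  have bound: "?f y \<le> C / 2 * ?f (y / 2)" if "t < \<bar>sqrt y\<bar>" for y
  proof (cases "y > 0")
    case y: True
    then have "t\<^sup>2 < y"
      using that assms(2) by (metis abs_of_pos power_strict_mono real_sqrt_gt_0_iff real_sqrt_pow2 less_imp_le pos2)
    then have ex: "exp (- y / 4) \<le> exp (- t\<^sup>2 / 4)" by simp
    have "(y / 2) powr (k / 2 - 1) = y powr (k / 2 - 1) * 2 / 2 powr (k / 2)"
      using y by (simp add: powr_divide powr_diff)
    then have "2 powr (k / 2) * exp (- y / 4) / 2 * ?f (y / 2)
        = (1 / 2) powr (k / 2) * y powr (k / 2 - 1) * (exp (- y / 4) * exp (- y / 4)) / Gamma (k / 2)"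
      using y by (simp add: chi_square_density_def field_simps)
    also have "\<dots> = ?f y"
      unfolding mult_exp_exp using y by (simp add: chi_square_density_def)
    finally have "?f y = 2 powr (k / 2) * exp (- y / 4) / 2 * ?f (y / 2)" ..
    also have "\<dots> \<le> C / 2 * ?f (y / 2)"
      unfolding C_def by (intro mult_right_mono divide_right_mono mult_left_mono ex f0) auto
    finally show ?thesis .
  next
    \<comment> \<open>\<open>sqrt\<close> is odd on the reals, so \<open>\<bar>sqrt y\<bar>\<close>
      may exceed \<open>t\<close> for negative \<open>y\<close> too; the density vanishes
      there.\<close>
    case False
    then show ?thesis using C f0 by (simp add: chi_square_density_def)
  qed
  have "emeasure (chi_distribution k) {x. t < \<bar>x\<bar>}
      = (\<integral>\<^sup>+y. ennreal (?f y) * indicator {y. t < \<bar>sqrt y\<bar>} y \<partial>lborel)"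
    by (simp add: chi_distribution_def emeasure_distr emeasure_density vimage_def)
  also have "\<dots> \<le> (\<integral>\<^sup>+y. ennreal (C / 2) * ?f (0 + 1 / 2 * y) \<partial>lborel)"
    using bound C f0 by (intro nn_integral_mono)
      (auto simp: ennreal_mult[symmetric] split: split_indicator intro!: ennreal_leI)
  also have "\<dots> = ennreal C * (ennreal \<bar>1 / 2\<bar> * (\<integral>\<^sup>+y. ?f (0 + 1 / 2 * y) \<partial>lborel))"
  proof -
    have split: "ennreal (C / 2) = ennreal C * ennreal \<bar>1 / 2\<bar>"
      using C by (subst ennreal_mult[symmetric]) auto
    show ?thesis
      unfolding mult.assoc[symmetric] split[symmetric] by (rule nn_integral_cmult[OF rescaled])
  qed
  also have "ennreal \<bar>1 / 2\<bar> * (\<integral>\<^sup>+y. ?f (0 + 1 / 2 * y) \<partial>lborel) = 1"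
    by (subst nn_integral_real_affine[symmetric]) (use mass in auto)
  finally show ?thesis
    unfolding C_def[symmetric] measure_def using C by (intro enn2real_leI) auto
qed

text \<open>Comparison with the normal density of variance 4.\<close>

lemma normal_tail_upper:
  assumes "t \<ge> 0"
  shows "measure (density lborel (normal_density 0 (sqrt 2))) {x. t < \<bar>x\<bar>} \<le> sqrt 2 * exp (- t\<^sup>2 / 8)"
proof -
  let ?C = "sqrt 2 * exp (- t\<^sup>2 / 8)"
  \<comment> \<open>The factor \<open>sqrt 2\<close> is the ratio of the standard deviations 2 and
    \<open>sqrt 2\<close>. The exponential splits evenly: one half becomes the tail factor, the
    other belongs to the wider density.\<close>
  have eq: "normal_density 0 (sqrt 2) x = sqrt 2 * exp (- x\<^sup>2 / 8) * normal_density 0 2 x" for x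
  proof -
    have "sqrt (2 * pi * 2\<^sup>2) = sqrt 2 * sqrt (2 * pi * (sqrt 2)\<^sup>2)"
      by (simp add: real_sqrt_mult[symmetric])
    moreover have "exp (- x\<^sup>2 / 4) = exp (- x\<^sup>2 / 8) * exp (- x\<^sup>2 / 8)"
      unfolding mult_exp_exp by simp
    ultimately show ?thesis
      by (simp add: normal_density_def)
  qed
  have bound: "normal_density 0 (sqrt 2) x \<le> ?C * normal_density 0 2 x" if "t < \<bar>x\<bar>" for x
  proof -
    have "t\<^sup>2 \<le> x\<^sup>2" using that assms by (metis abs_le_square_iff abs_of_nonneg less_imp_le)
    then show ?thesis
      unfolding eq by (intro mult_right_mono mult_left_mono) auto
  qed
  have "emeasure (density lborel (normal_density 0 (sqrt 2))) {x. t < \<bar>x\<bar>}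
     = (\<integral>\<^sup>+x. ennreal (normal_density 0 (sqrt 2) x) * indicator {x. t < \<bar>x\<bar>} x \<partial>lborel)"
    by (simp add: emeasure_density)
  also have "\<dots> \<le> (\<integral>\<^sup>+x. ennreal ?C * normal_density 0 2 x \<partial>lborel)"
    using bound by (intro nn_integral_mono)
      (auto simp: ennreal_mult[symmetric] split: split_indicator intro!: ennreal_leI)
  also have "\<dots> = ennreal ?C"
    using prob_space.emeasure_space_1[OF prob_space_normal_density[of 2 0]]
    by (subst nn_integral_cmult) (auto simp: emeasure_density)
  finally show ?thesis
    unfolding measure_def by (intro enn2real_leI) auto
qed

text \<open>Integrate only over the unit interval from \<open>s\<close> to \<open>s + 1\<close>,
  where the density is at least its value at the right endpoint.\<close>

lemma normal_tail_lower:
  assumes "s \<ge> 0"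
  shows "exp (- (s + 1)\<^sup>2 / 4) / sqrt (4 * pi) \<le> measure (density lborel (normal_density 0 (sqrt 2))) {s..}"
proof -
  let ?c = "exp (- (s + 1)\<^sup>2 / 4) / sqrt (4 * pi)"
  interpret N: prob_space "density lborel (normal_density 0 (sqrt 2))"
    by (rule prob_space_normal_density) simp
  have bound: "?c \<le> normal_density 0 (sqrt 2) x" if "s \<le> x" "x \<le> s + 1" for x
  proof -
    have "x\<^sup>2 \<le> (s + 1)\<^sup>2" using that assms by (intro power_mono) auto
    then show ?thesis by (simp add: normal_density_def divide_right_mono)
  qed
  have "ennreal ?c = (\<integral>\<^sup>+x. ennreal ?c * indicator {s..s + 1} x \<partial>lborel)"
    by (simp add: nn_integral_cmult_indicator)
  also have "\<dots> \<le> (\<integral>\<^sup>+x. ennreal (normal_density 0 (sqrt 2) x) * indicator {s..} x \<partial>lborel)"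
    using bound by (intro nn_integral_mono) (auto split: split_indicator intro!: ennreal_leI)
  also have "\<dots> = emeasure (density lborel (normal_density 0 (sqrt 2))) {s..}"
    by (simp add: emeasure_density)
  finally show ?thesis
    by (simp add: N.emeasure_eq_measure)
qed

section \<open>Measurability of the largest eigenvalue\<close>

text \<open>Both sides of the inequality are continuous in \<open>y\<close>, so rational test
  vectors suffice. They are taken extensional on \<open>{..<n}\<close> because the rational-valued
  functions on all of \<open>nat\<close> are uncountable.\<close>

lemma max_eigenvalue_le_iff_rational:
  assumes A: "A \<in> carrier_mat n n" and n: "n \<ge> 1"
    and sym: "\<And>i j. i < n \<Longrightarrow> j < n \<Longrightarrow> A $$ (i, j) = A $$ (j, i)"
  shows "max_eigenvalue A \<le> t \<longleftrightarrow>
    (\<forall>y \<in> {..<n} \<rightarrow>\<^sub>E \<rat>. quadratic_form n A y \<le> t * (\<Sum>i<n. (y i)\<^sup>2))"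
proof -
  have "quadratic_form n A y \<le> t * (\<Sum>i<n. (y i)\<^sup>2)"
    if rat: "\<forall>y \<in> {..<n} \<rightarrow>\<^sub>E \<rat>. quadratic_form n A y \<le> t * (\<Sum>i<n. (y i)\<^sup>2)"
    for y :: "nat \<Rightarrow> real"
  proof -
    have "\<exists>q::real \<in> \<rat>. dist q (y i) < 1 / real (Suc k)" for i k
    proof -
      obtain q where "y i < real_of_rat q" "real_of_rat q < y i + 1 / real (Suc k)"
        using of_rat_dense[of "y i" "y i + 1 / real (Suc k)"] by auto
      then show ?thesis by (intro bexI[of _ "real_of_rat q"]) (auto simp: dist_real_def)
    qed
    then obtain q where q: "\<And>i k. q i k \<in> \<rat>" "\<And>i k. dist (q i k) (y i) < 1 / real (Suc k)"
      by metis
    have lim: "(\<lambda>k. q i k) \<longlonglongrightarrow> y i" for i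
    proof (rule tendsto_dist_iff[THEN iffD2])
      show "(\<lambda>k. dist (q i k) (y i)) \<longlonglongrightarrow> 0"
        by (rule tendsto_sandwich[OF _ _ tendsto_const LIMSEQ_Suc[OF lim_1_over_n]])
          (use q(2) in \<open>auto intro!: always_eventually less_imp_le\<close>)
    qed
    have le: "quadratic_form n A (\<lambda>i. q i k) \<le> t * (\<Sum>i<n. (q i k)\<^sup>2)" for k
      using rat[rule_format, of "restrict (\<lambda>i. q i k) {..<n}"] q(1)
        quadratic_form_cong[of n "restrict (\<lambda>i. q i k) {..<n}" "\<lambda>i. q i k" A] by simp
    have lim1: "(\<lambda>k. quadratic_form n A (\<lambda>i. q i k)) \<longlonglongrightarrow> quadratic_form n A y"
      unfolding quadratic_form_def by (intro tendsto_intros lim)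
    have lim2: "(\<lambda>k. t * (\<Sum>i<n. (q i k)\<^sup>2)) \<longlonglongrightarrow> t * (\<Sum>i<n. (y i)\<^sup>2)"
      by (intro tendsto_intros lim)
    show "quadratic_form n A y \<le> t * (\<Sum>i<n. (y i)\<^sup>2)"
      by (rule LIMSEQ_le[OF lim1 lim2]) (use le in auto)
  qed
  then show ?thesis
    using max_eigenvalue_le_iff[OF A n sym] by blast
qed

text \<open>The rational criterion writes each sublevel set as a countable intersection of events,
  each comparing a polynomial in the entries with a constant.\<close>

lemma borel_measurable_max_eigenvalue:
  assumes n: "n \<ge> 1"
    and carrier: "\<And>\<omega>. \<omega> \<in> space M \<Longrightarrow> A \<omega> \<in> carrier_mat n n"
    and sym: "\<And>\<omega> i j. \<omega> \<in> space M \<Longrightarrow> i < n \<Longrightarrow> j < n \<Longrightarrow> A \<omega> $$ (i, j) = A \<omega> $$ (j, i)"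
    and meas: "\<And>i j. i < n \<Longrightarrow> j < n \<Longrightarrow> (\<lambda>\<omega>. A \<omega> $$ (i, j)) \<in> borel_measurable M"
  shows "(\<lambda>\<omega>. max_eigenvalue (A \<omega>)) \<in> borel_measurable M"
proof (rule borel_measurable_iff_le[THEN iffD2], intro allI)
  fix t
  let ?Q = "{..<n} \<rightarrow>\<^sub>E (\<rat>::real set)"
  have countable: "countable ?Q"
    by (intro countable_PiE) (auto simp: countable_rat)
  have "{\<omega> \<in> space M. max_eigenvalue (A \<omega>) \<le> t}
      = {\<omega> \<in> space M. \<forall>y\<in>?Q. quadratic_form n (A \<omega>) y \<le> t * (\<Sum>i<n. (y i)\<^sup>2)}"
    using max_eigenvalue_le_iff_rational[OF carrier n sym] by auto
  also have "\<dots> \<in> sets M"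
  proof (rule sets.sets_Collect_countable_All'[OF _ countable])
    fix y :: "nat \<Rightarrow> real"
    have "(\<lambda>\<omega>. quadratic_form n (A \<omega>) y) \<in> borel_measurable M"
      unfolding quadratic_form_def by (intro borel_measurable_sum borel_measurable_times meas) auto
    then show "{\<omega> \<in> space M. quadratic_form n (A \<omega>) y \<le> t * (\<Sum>i<n. (y i)\<^sup>2)} \<in> sets M"
      by measurable
  qed
  finally show "{\<omega> \<in> space M. max_eigenvalue (A \<omega>) \<le> t} \<in> sets M" .
qed

section \<open>Probability estimates for the random tridiagonal matrix\<close>

lemma tridiagonal_beta_matrixD:
  assumes "tridiagonal_beta_matrix M n b H"
  shows "prob_space M"
    and "\<omega> \<in> space M \<Longrightarrow> H \<omega> \<in> carrier_mat n n"
    and "\<omega> \<in> space M \<Longrightarrow> i < n \<Longrightarrow> j < n \<Longrightarrow> H \<omega> $$ (i, j) = H \<omega> $$ (j, i)"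
    and "\<omega> \<in> space M \<Longrightarrow> i < n \<Longrightarrow> j < n \<Longrightarrow> Suc i < j \<Longrightarrow> H \<omega> $$ (i, j) = 0"
    and "prob_space.indep_vars M (\<lambda>_. borel) (\<lambda>ij \<omega>. H \<omega> $$ ij)
       {(i, j). i < n \<and> j < n \<and> (j = i \<or> j = Suc i)}"
    and "i < n \<Longrightarrow> distr M borel (\<lambda>\<omega>. H \<omega> $$ (i, i)) = density lborel (normal_density 0 (sqrt 2))"
    and "Suc i < n \<Longrightarrow> distr M borel (\<lambda>\<omega>. H \<omega> $$ (i, Suc i)) = chi_distribution (real (n - Suc i) * b)"
proof -
  show "i < n \<Longrightarrow> distr M borel (\<lambda>\<omega>. H \<omega> $$ (i, i)) = density lborel (normal_density 0 (sqrt 2))"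
    using assms distributed_distr_eq_density[of M lborel "\<lambda>\<omega>. H \<omega> $$ (i, i)"]
    by (auto simp: tridiagonal_beta_matrix_def cong: distr_cong)
qed (use assms in \<open>auto simp: tridiagonal_beta_matrix_def\<close>)

text \<open>Independence includes measurability of the diagonal and superdiagonal entries; above
  them the entry is 0 on the sample space, and below the diagonal symmetry applies.\<close>

lemma tridiagonal_beta_matrix_measurable_entry:
  assumes H: "tridiagonal_beta_matrix M n b H" and ij: "i < n" "j < n"
  shows "(\<lambda>\<omega>. H \<omega> $$ (i, j)) \<in> borel_measurable M"
proof -
  interpret prob_space M using tridiagonal_beta_matrixD(1)[OF H] .
  have upper: "(\<lambda>\<omega>. H \<omega> $$ (i, j)) \<in> borel_measurable M" if "i < n" "j < n" "i \<le> j" for i j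
  proof (cases "j \<le> Suc i")
    case True
    have "\<forall>ij\<in>{(i, j). i < n \<and> j < n \<and> (j = i \<or> j = Suc i)}. (\<lambda>\<omega>. H \<omega> $$ ij) \<in> borel_measurable M"
      using tridiagonal_beta_matrixD(5)[OF H] unfolding indep_vars_def by blast
    moreover have "j = i \<or> j = Suc i" using True \<open>i \<le> j\<close> by linarith
    ultimately show ?thesis using that by blast
  next
    case False
    then have "(\<lambda>\<omega>. H \<omega> $$ (i, j)) \<in> borel_measurable M \<longleftrightarrow> (\<lambda>\<omega>. 0 :: real) \<in> borel_measurable M"
      by (intro measurable_cong tridiagonal_beta_matrixD(4)[OF H]) (use that in auto)
    then show ?thesis by simp
  qed
  show ?thesis
  proof (cases "i \<le> j")
    case False
    have "(\<lambda>\<omega>. H \<omega> $$ (i, j)) \<in> borel_measurable M \<longleftrightarrow> (\<lambda>\<omega>. H \<omega> $$ (j, i)) \<in> borel_measurable M"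
      by (intro measurable_cong tridiagonal_beta_matrixD(3)[OF H] ij)
    then show ?thesis using upper[of j i] ij False by simp
  qed (use upper ij in auto)
qed

text \<open>A largest eigenvalue below \<open>s\<close> forces every diagonal entry below
  \<open>s\<close>. By independence this has probability at most the \<open>n\<close>-th power of
  \<open>1 - p\<close>, where \<open>p\<close> is the lower bound on the Gaussian tail, and
  \<open>1 - p\<close> is at most \<open>exp (- p)\<close>.\<close>

lemma tridiagonal_beta_matrix_lower:
  assumes H: "tridiagonal_beta_matrix M n b H" and n: "n \<ge> 1" and s: "s \<ge> 0"
  shows "measure M {\<omega> \<in> space M. max_eigenvalue (H \<omega>) < s}
    \<le> exp (- real n * (exp (- (s + 1)\<^sup>2 / 4) / sqrt (4 * pi)))"
proof -
  interpret prob_space M using tridiagonal_beta_matrixD(1)[OF H] .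
  note meas = tridiagonal_beta_matrix_measurable_entry[OF H]
  let ?N = "density lborel (normal_density 0 (sqrt 2))"
  define p where "p = exp (- (s + 1)\<^sup>2 / 4) / sqrt (4 * pi)"
  interpret N: prob_space ?N by (rule prob_space_normal_density) simp
  define E where "E i = (\<lambda>\<omega>. H \<omega> $$ (i, i)) -` {..<s} \<inter> space M" for i
  \<comment> \<open>The independent family is indexed by positions in the band; \<open>J\<close>
    selects the diagonal ones.\<close>
  define J where "J = (\<lambda>i. (i, i)) ` {..<n}"
  have E: "E i \<in> events" if "i < n" for i
    unfolding E_def using meas[OF that that] by measurable
  have probE: "prob (E i) \<le> exp (- p)" if "i < n" for i
  proof -
    have "prob (E i) = measure (distr M borel (\<lambda>\<omega>. H \<omega> $$ (i, i))) {..<s}"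
      unfolding E_def by (rule measure_distr[symmetric]) (use meas that in auto)
    also have "\<dots> = measure ?N (space ?N - {s..})"
      unfolding tridiagonal_beta_matrixD(6)[OF H that] by (intro arg_cong[where f = "measure ?N"]) auto
    also have "\<dots> = 1 - measure ?N {s..}"
      by (rule N.prob_compl) simp
    also have "\<dots> \<le> 1 - p"
      using normal_tail_lower[OF s] by (simp add: p_def)
    also have "\<dots> \<le> exp (- p)"
      using exp_ge_add_one_self[of "- p"] by simp
    finally show ?thesis .
  qed
  have "prob {\<omega> \<in> space M. max_eigenvalue (H \<omega>) < s} \<le> prob (\<Inter>i<n. E i)"
  proof (rule finite_measure_mono)
    show "{\<omega> \<in> space M. max_eigenvalue (H \<omega>) < s} \<subseteq> (\<Inter>i<n. E i)"
    proof safe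
      fix \<omega> i assume \<omega>: "\<omega> \<in> space M" "max_eigenvalue (H \<omega>) < s" and i: "i < n"
      have "H \<omega> $$ (i, i) \<le> max_eigenvalue (H \<omega>)"
        using tridiagonal_beta_matrixD(2,3)[OF H \<omega>(1)] n i by (intro diagonal_le_max_eigenvalue[of _ n]) auto
      with \<omega> show "\<omega> \<in> E i" by (simp add: E_def)
    qed
    show "(\<Inter>i<n. E i) \<in> events"
    proof (rule sets.finite_INT)
      have "0 \<in> {..<n}" using n by simp
      then show "{..<n} \<noteq> {}" by blast
    qed (use E in auto)
  qed
  also have "(\<Inter>i<n. E i) = (\<Inter>ij\<in>J. (\<lambda>\<omega>. H \<omega> $$ ij) -` {..<s} \<inter> space M)"
    by (simp add: E_def J_def)
  also have "prob \<dots> = (\<Prod>ij\<in>J. prob ((\<lambda>\<omega>. H \<omega> $$ ij) -` {..<s} \<inter> space M))"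
  proof (rule indep_varsD[OF tridiagonal_beta_matrixD(5)[OF H]])
    have "(0, 0) \<in> J" using n by (simp add: J_def)
    then show "J \<noteq> {}" by blast
  qed (auto simp: J_def)
  also have "\<dots> = (\<Prod>i<n. prob (E i))"
    unfolding J_def E_def by (subst prod.reindex) (auto simp: inj_on_def)
  also have "\<dots> \<le> (\<Prod>i<n. exp (- p))"
    by (intro prod_mono) (use probE in auto)
  also have "\<dots> = exp (- real n * p)"
    by (simp add: exp_of_nat_mult[symmetric])
  finally show ?thesis unfolding p_def .
qed

text \<open>If the largest eigenvalue exceeds \<open>3 * t\<close>, some diagonal or superdiagonal
  entry exceeds \<open>t\<close> in absolute value. A union bound over the rows, with at most two
  such entries in each, gives the estimate.\<close>

lemma tridiagonal_beta_matrix_upper: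
  assumes H: "tridiagonal_beta_matrix M n b H" and n: "n \<ge> 1" and t: "t \<ge> 0"
    and b: "b > 0" "real n * b \<le> K"
  shows "measure M {\<omega> \<in> space M. 3 * t < max_eigenvalue (H \<omega>)}
    \<le> real n * ((sqrt 2 + 2 powr (K / 2)) * exp (- t\<^sup>2 / 8))"
proof -
  interpret prob_space M using tridiagonal_beta_matrixD(1)[OF H] .
  note meas = tridiagonal_beta_matrix_measurable_entry[OF H]
  define T where "T i j = (\<lambda>\<omega>. H \<omega> $$ (i, j)) -` {x. t < \<bar>x\<bar>} \<inter> space M" for i j
  have T: "T i j \<in> events" if "i < n" "j < n" for i j
    unfolding T_def using meas[OF that] by measurable
  have T_distr: "prob (T i j) = measure (distr M borel (\<lambda>\<omega>. H \<omega> $$ (i, j))) {x. t < \<bar>x\<bar>}"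
    if "i < n" "j < n" for i j
    unfolding T_def by (rule measure_distr[symmetric]) (use meas that in auto)
  have diag: "prob (T i i) \<le> sqrt 2 * exp (- t\<^sup>2 / 8)" if "i < n" for i
    unfolding T_distr[OF that that] tridiagonal_beta_matrixD(6)[OF H that] by (rule normal_tail_upper[OF t])
  have off: "prob (T i (Suc i)) \<le> 2 powr (K / 2) * exp (- t\<^sup>2 / 8)" if i: "Suc i < n" for i
  proof -
    define k where "k = real (n - Suc i) * b"
    have k: "k > 0" using b i by (simp add: k_def)
    have "k \<le> real n * b"
      unfolding k_def using b by (intro mult_right_mono) auto
    with b have kK: "k \<le> K" by linarith
    \<comment> \<open>Total mass 1 is read off from the matrix: this measure is the law of one of
      its entries.\<close>
    have "prob_space (chi_distribution k)"
      unfolding k_def tridiagonal_beta_matrixD(7)[OF H i, symmetric]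
      by (intro prob_space_distr meas) (use i in auto)
    then have "prob (T i (Suc i)) \<le> 2 powr (k / 2) * exp (- t\<^sup>2 / 4)"
      using chi_distribution_tail[OF k t] i
      by (simp add: T_distr tridiagonal_beta_matrixD(7)[OF H i] k_def)
    \<comment> \<open>The parameter is replaced by its uniform bound \<open>K\<close>, and the rate
      1/4 is weakened to 1/8, the rate of the Gaussian entries.\<close>
    also have "\<dots> \<le> 2 powr (K / 2) * exp (- t\<^sup>2 / 8)"
      using kK by (intro mult_mono powr_mono) auto
    finally show ?thesis .
  qed
  \<comment> \<open>One event per row; the last row has no superdiagonal entry.\<close>
  define U where "U i = T i i \<union> (if Suc i < n then T i (Suc i) else {})" for i
  have U: "U i \<in> events" if "i < n" for i
    using T that by (auto simp: U_def)
  have "prob {\<omega> \<in> space M. 3 * t < max_eigenvalue (H \<omega>)} \<le> prob (\<Union>i<n. U i)"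
  proof (rule finite_measure_mono)
    show "{\<omega> \<in> space M. 3 * t < max_eigenvalue (H \<omega>)} \<subseteq> (\<Union>i<n. U i)"
    proof (rule subsetI, rule ccontr)
      fix \<omega> assume \<omega>: "\<omega> \<in> {\<omega> \<in> space M. 3 * t < max_eigenvalue (H \<omega>)}" "\<omega> \<notin> (\<Union>i<n. U i)"
      then have sp: "\<omega> \<in> space M" by simp
      have "\<bar>H \<omega> $$ (i, i)\<bar> \<le> t" if "i < n" for i
        using \<omega> that by (auto simp: U_def T_def not_less)
      moreover have "\<bar>H \<omega> $$ (i, Suc i)\<bar> \<le> t" if "Suc i < n" for i
      proof -
        from \<omega> Suc_lessD[OF that] have "\<omega> \<notin> U i" by blast
        then show ?thesis using that sp by (simp add: U_def T_def not_less)
      qed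
      ultimately have "max_eigenvalue (H \<omega>) \<le> 3 * t"
        using tridiagonal_beta_matrixD(2-4)[OF H sp] n by (intro max_eigenvalue_tridiagonal_le[of _ n]) auto
      with \<omega> show False by simp
    qed
    show "(\<Union>i<n. U i) \<in> events" using U by auto
  qed
  also have "\<dots> \<le> (\<Sum>i<n. prob (U i))"
    by (intro finite_measure_subadditive_finite) (use U in auto)
  also have "\<dots> \<le> (\<Sum>i<n. (sqrt 2 + 2 powr (K / 2)) * exp (- t\<^sup>2 / 8))"
  proof (intro sum_mono)
    fix i assume "i \<in> {..<n}"
    then have i: "i < n" by simp
    show "prob (U i) \<le> (sqrt 2 + 2 powr (K / 2)) * exp (- t\<^sup>2 / 8)"
    proof (cases "Suc i < n")
      case True
      then have "prob (U i) \<le> prob (T i i) + prob (T i (Suc i))"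
        unfolding U_def using T i by (auto intro!: measure_Un_le)
      also have "\<dots> \<le> sqrt 2 * exp (- t\<^sup>2 / 8) + 2 powr (K / 2) * exp (- t\<^sup>2 / 8)"
        by (intro add_mono diag off i True)
      finally show ?thesis by (simp add: distrib_right)
    next
      case False
      then show ?thesis
        using diag[OF i] by (simp add: U_def distrib_right add_increasing2)
    qed
  qed
  finally show ?thesis by simp
qed

section \<open>Convergence of the probability in both regimes\<close>

theorem corollary1p4:
  fixes \<beta> :: "nat \<Rightarrow> real"
    and M :: "nat \<Rightarrow> 'a measure"
    and H :: "nat \<Rightarrow> 'a \<Rightarrow> real mat"
  assumes "\<And>n. n \<ge> 1 \<Longrightarrow> \<beta> n > 0"
    and "((\<lambda>n. 1 / (real n)^2) \<lless> \<beta> \<and> \<beta> \<lless> (\<lambda>n. 1 / real n)) \<or>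
         (\<exists>\<gamma>. 0 < \<gamma> \<and> \<gamma> < 1 \<and> (\<forall>n\<ge>1. \<beta> n = 2 * \<gamma> / real n))"
    and "\<And>n. n \<ge> 1 \<Longrightarrow> tridiagonal_beta_matrix (M n) n (\<beta> n) (H n)"
  shows "\<exists>c c'. 0 < c \<and> c < c' \<and>
           (\<lambda>n. measure (M n)
              {\<omega> \<in> space (M n). max_eigenvalue (H n \<omega>) / sqrt (ln (real n)) \<in> {c..c'}})
             \<longlonglongrightarrow> 1"
proof -
  note beta = assms(1) and regime = assms(2) and H = assms(3)
  \<comment> \<open>Every parameter \<open>(n - i) * \<beta> n\<close> is at most
    \<open>n * \<beta> n\<close>. This product tends to 0 in the first regime and equals
    \<open>2 * \<gamma> < 2\<close> in the second, so 2 serves both.\<close>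
  have bounded: "\<forall>\<^sub>F n in sequentially. real n * \<beta> n \<le> 2"
    using regime
  proof (elim disjE conjE exE)
    assume "\<beta> \<lless> (\<lambda>n. 1 / real n)"
    then have "(\<lambda>n. real n * \<beta> n) \<longlonglongrightarrow> 0"
      by (simp add: much_less_def mult.commute)
    from order_tendstoD(2)[OF this, of 2] show ?thesis
      by (auto elim: eventually_mono)
  next
    fix \<gamma> :: real assume "\<gamma> < 1" "\<forall>n\<ge>1. \<beta> n = 2 * \<gamma> / real n"
    then show ?thesis
      by (intro eventually_mono[OF eventually_ge_at_top[of 1]]) auto
  qed
  define L where "L n = sqrt (ln (real n))" for n
  \<comment> \<open>The lower estimate is used with \<open>s = L n\<close>, the upper one with
    \<open>t = 4 * L n\<close> and \<open>K = 2\<close>; hence the endpoints 1 and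
    \<open>12 = 3 * 4\<close>. The two error terms below are the resulting bounds.\<close>
  define P where "P n = measure (M n) {\<omega> \<in> space (M n). max_eigenvalue (H n \<omega>) / L n \<in> {1..12}}" for n
  define \<epsilon>\<^sub>1 where "\<epsilon>\<^sub>1 n = exp (- real n * (exp (- (L n + 1)\<^sup>2 / 4) / sqrt (4 * pi)))" for n
  define \<epsilon>\<^sub>2 where "\<epsilon>\<^sub>2 n = real n * ((sqrt 2 + 2 powr (2 / 2)) * exp (- (4 * L n)\<^sup>2 / 8))" for n
  have "\<forall>\<^sub>F n in sequentially. 1 - P n \<le> \<epsilon>\<^sub>1 n + \<epsilon>\<^sub>2 n \<and> P n \<le> 1"
    using bounded eventually_ge_at_top[of 2]
  proof eventually_elim
    case (elim n)
    \<comment> \<open>From \<open>n = 2\<close> on the logarithm is positive, so division by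
      \<open>L n\<close> preserves the inequalities.\<close>
    then have n: "n \<ge> 1" and L: "L n > 0" by (auto simp: L_def)
    note Hn = H[OF n]
    interpret prob_space "M n" using tridiagonal_beta_matrixD(1)[OF Hn] .
    let ?top = "\<lambda>\<omega>. max_eigenvalue (H n \<omega>)"
    \<comment> \<open>Passing to the complement requires the event in \<open>P n\<close> to be
      measurable.\<close>
    have [measurable]: "?top \<in> borel_measurable (M n)"
      by (rule borel_measurable_max_eigenvalue[OF n])
        (use tridiagonal_beta_matrixD(2,3)[OF Hn] tridiagonal_beta_matrix_measurable_entry[OF Hn] in auto)
    have "1 - P n = prob (space (M n) - {\<omega> \<in> space (M n). ?top \<omega> / L n \<in> {1..12}})"
      unfolding P_def by (rule prob_compl[symmetric]) measurable
    also have "\<dots> \<le> prob ({\<omega> \<in> space (M n). ?top \<omega> < L n} \<union> {\<omega> \<in> space (M n). 3 * (4 * L n) < ?top \<omega>})"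
      using L by (intro finite_measure_mono) (auto simp: field_simps)
    also have "\<dots> \<le> prob {\<omega> \<in> space (M n). ?top \<omega> < L n} + prob {\<omega> \<in> space (M n). 3 * (4 * L n) < ?top \<omega>}"
      by (rule measure_Un_le) measurable
    also have "\<dots> \<le> \<epsilon>\<^sub>1 n + \<epsilon>\<^sub>2 n"
      unfolding \<epsilon>\<^sub>1_def \<epsilon>\<^sub>2_def
      using L tridiagonal_beta_matrix_lower[OF Hn n, of "L n"]
        tridiagonal_beta_matrix_upper[OF Hn n _ beta[OF n] elim(1), of "4 * L n"] by simp
    finally show ?case by (simp add: P_def)
  qed
  then have bounds: "\<forall>\<^sub>F n in sequentially. 1 - (\<epsilon>\<^sub>1 n + \<epsilon>\<^sub>2 n) \<le> P n" "\<forall>\<^sub>F n in sequentially. P n \<le> 1"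
    by (auto elim: eventually_mono)
  \<comment> \<open>The exponent is, up to a negative constant factor,
    \<open>n powr (3/4) * exp (- L n / 2)\<close>, which tends to infinity in absolute value because
    \<open>L n\<close> grows more slowly than \<open>ln n\<close>.\<close>
  have "\<epsilon>\<^sub>1 \<longlonglongrightarrow> 0"
    unfolding \<epsilon>\<^sub>1_def L_def by real_asymp
  \<comment> \<open>With \<open>t = 4 * L n\<close> the exponent is \<open>- 2 * ln n\<close>, so
    the union bound over \<open>n\<close> rows leaves a multiple of \<open>1 / n\<close>.\<close>
  moreover have "\<epsilon>\<^sub>2 \<longlonglongrightarrow> 0"
  proof (rule Lim_transform_eventually)
    show "(\<lambda>n. (sqrt 2 + 2) / real n) \<longlonglongrightarrow> 0"
      by real_asymp
    show "\<forall>\<^sub>F n in sequentially. (sqrt 2 + 2) / real n = \<epsilon>\<^sub>2 n"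
      using eventually_ge_at_top[of 1]
    proof eventually_elim
      case (elim n)
      then have "- (4 * L n)\<^sup>2 / 8 = - (ln (real n) + ln (real n))"
        by (simp add: L_def power_mult_distrib)
      with elim have "exp (- (4 * L n)\<^sup>2 / 8) = 1 / (real n * real n)"
        by (simp only: exp_minus exp_add exp_ln) (simp add: inverse_eq_divide)
      with elim show ?case by (simp add: \<epsilon>\<^sub>2_def)
    qed
  qed
  ultimately have "(\<lambda>n. 1 - (\<epsilon>\<^sub>1 n + \<epsilon>\<^sub>2 n)) \<longlonglongrightarrow> 1 - (0 + 0)"
    by (intro tendsto_intros)
  then have "P \<longlonglongrightarrow> 1"
    using tendsto_sandwich[OF bounds _ tendsto_const] by simp
  then show ?thesis
    unfolding P_def L_def by (intro exI[of _ 1] exI[of _ 12]) auto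
qed

end
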